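(* Let $(\Omega,\mathcal{F},\mathbb{P})$ be a probability space, $\mathcal{I}\subset\mathbb{R}$ an interval, and $u:\mathcal{I}\to\mathbb{R}$ a utility function, i.e. a strictly increasing continuous function. Let $0<t_1<\dots<t_m=T$ be times, let $X_k$ ($k=1,\dots,m$) be $\mathcal{I}$-valued random variables (the cash flow at time $t_k$), and write $X_T=X_m$. Let $\{\emptyset,\Omega\}=\mathcal{G}_0\subset\mathcal{G}_1\subset\mathcal{G}_2\subset\dots\subset\mathcal{G}_m\subset\mathcal{F}$ be sub-$\sigma$-algebras such that $X_k$ is $\mathcal{G}_k$-measurable for $k=1,\dots,m$, and suppose that each $u(X_k)$ is integrable. Define $$\pi_k=C(T\mid\mathcal{G}_k)=u^{-1}\big(E[u(X_T)\mid\mathcal{G}_k]\big),\qquad k=0,1,\dots,m.$$ Then $\{\pi_k : k=0,1,\dots,m\}$ is a $u$-martingale with respect to $(\Omega,\{\mathcal{G}_k\}_{k=0,1,\dots,m},\mathbb{P})$, with value $\pi_0=C(T)=u^{-1}\big(E[u(X_T)]\big)$ at $t=0$.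
   Context: $E$ denotes expectation with respect to $\mathbb{P}$, and $u^{-1}$ is the inverse of $u$, defined on $u(\mathcal{I})$. For an $\mathcal{I}$-valued random variable $Y$ with $E[|u(Y)|]<\infty$ and a sub-$\sigma$-algebra $\mathcal{G}$, the $u$-conditional expectation is $E_u[Y\mid\mathcal{G}]=u^{-1}\big(E[u(Y)\mid\mathcal{G}]\big)$. A sequence $\{\pi_k\}_{k=0}^m$ of $\mathcal{I}$-valued random variables is a $u$-martingale with respect to $\{\mathcal{G}_k\}$ if each $\pi_k$ is $\mathcal{G}_k$-measurable with $E[|u(\pi_k)|]<\infty$, and $E_u[\pi_{l}\mid\mathcal{G}_k]=\pi_k$ $\mathbb{P}$-almost surely for all $0\le k\le l\le m$. *)

theory Defs
  imports "HOL-Probability.Probability"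
begin

text \<open>
  The conditional expectation \<open>real_cond_exp M G\<close> is a function chosen among its versions, so it may
  leave the range \<open>u ` I\<close>, where the inverse of \<open>u\<close> is undefined, on a null set.  There the value is
  an arbitrary fixed point of \<open>I\<close>, which makes \<open>u_cond_exp\<close> valued in \<open>I\<close> everywhere.  The lemma
  \<open>AE_real_cond_exp_in_range\<close> below shows that this case has probability zero.
\<close>

definition u_cond_exp ::
    "'a measure \<Rightarrow> real set \<Rightarrow> (real \<Rightarrow> real) \<Rightarrow> 'a measure \<Rightarrow> ('a \<Rightarrow> real) \<Rightarrow> 'a \<Rightarrow> real" where
  "u_cond_exp M I u G Y \<omega> =
     (let z = real_cond_exp M G (\<lambda>\<omega>'. u (Y \<omega>')) \<omega>
      in if z \<in> u ` I then the_inv_into I u z else (SOME c. c \<in> I))"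

text \<open>The unconditional certainty equivalent \<open>u\<inverse>(E[u(Y)])\<close>; see \<open>expectation_in_range\<close>.\<close>

definition certainty_equiv ::
    "'a measure \<Rightarrow> real set \<Rightarrow> (real \<Rightarrow> real) \<Rightarrow> ('a \<Rightarrow> real) \<Rightarrow> real" where
  "certainty_equiv M I u Y = the_inv_into I u (\<integral>\<omega>. u (Y \<omega>) \<partial>M)"

definition u_martingale ::
    "'a measure \<Rightarrow> real set \<Rightarrow> (real \<Rightarrow> real) \<Rightarrow> nat \<Rightarrow> (nat \<Rightarrow> 'a measure) \<Rightarrow> (nat \<Rightarrow> 'a \<Rightarrow> real) \<Rightarrow> bool" where
  "u_martingale M I u m G \<pi> \<longleftrightarrow>
     (\<forall>k\<le>m. \<pi> k \<in> space M \<rightarrow> I \<and> \<pi> k \<in> borel_measurable (G k)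
            \<and> integrable M (\<lambda>\<omega>. u (\<pi> k \<omega>)))
     \<and> (\<forall>k l. k \<le> l \<and> l \<le> m \<longrightarrow> (AE \<omega> in M. u_cond_exp M I u (G k) (\<pi> l) \<omega> = \<pi> k \<omega>))"

lemma is_interval_range:
  fixes u :: "real \<Rightarrow> real"
  assumes "is_interval I" and "continuous_on I u"
  shows "is_interval (u ` I)"
  using assms by (simp add: is_interval_connected_1 connected_continuous_image)

lemma (in prob_space) AE_real_cond_exp_in_interval:
  assumes "subalgebra M G" and f: "integrable M f" and J: "AE \<omega> in M. f \<omega> \<in> J" "is_interval J"
  shows "AE \<omega> in M. real_cond_exp M G f \<omega> \<in> J"
proof -
  interpret finite_measure_subalgebra M G
    using assms(1) by unfold_locales
  have "J \<noteq> {}"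
  proof
    assume "J = {}"
    then have "AE \<omega> in M. False" using J(1) by simp
    then show False by simp
  qed
  have lo: "AE \<omega> in M. \<exists>a\<in>J. a \<le> real_cond_exp M G f \<omega>"
  proof (cases "bdd_below J")
    case bdd: True
    show ?thesis
    proof (cases "Inf J \<in> J")
      case True
      have "AE \<omega> in M. Inf J \<le> f \<omega>"
        using J(1) by eventually_elim (rule cInf_lower[OF _ bdd])
      then have "AE \<omega> in M. Inf J \<le> real_cond_exp M G f \<omega>"
        by (rule real_cond_exp_ge_c[OF f])
      then show ?thesis using True by auto
    next
      case False
      have "AE \<omega> in M. Inf J < f \<omega>"
        using J(1) by eventually_elim (metis False bdd cInf_lower order_le_less)
      then have "AE \<omega> in M. Inf J < real_cond_exp M G f \<omega>"
        by (rule real_cond_exp_gr_c[OF f])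
      then show ?thesis
        by eventually_elim (use cInf_lessD[OF \<open>J \<noteq> {}\<close>] less_imp_le in blast)
    qed
  next
    case False
    then have "\<exists>a\<in>J. a \<le> x" for x
      by (meson bdd_belowI linear)
    then show ?thesis by simp
  qed
  have hi: "AE \<omega> in M. \<exists>b\<in>J. real_cond_exp M G f \<omega> \<le> b"
  proof (cases "bdd_above J")
    case bdd: True
    show ?thesis
    proof (cases "Sup J \<in> J")
      case True
      have "AE \<omega> in M. f \<omega> \<le> Sup J"
        using J(1) by eventually_elim (rule cSup_upper[OF _ bdd])
      then have "AE \<omega> in M. real_cond_exp M G f \<omega> \<le> Sup J"
        by (rule real_cond_exp_le_c[OF f])
      then show ?thesis using True by auto
    next
      case False
      have "AE \<omega> in M. f \<omega> < Sup J"
        using J(1) by eventually_elim (metis False bdd cSup_upper order_le_less)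
      then have "AE \<omega> in M. real_cond_exp M G f \<omega> < Sup J"
        by (rule real_cond_exp_less_c[OF f])
      then show ?thesis
        by eventually_elim (use less_cSupD[OF \<open>J \<noteq> {}\<close>] less_imp_le in blast)
    qed
  next
    case False
    then have "\<exists>b\<in>J. x \<le> b" for x
      by (meson bdd_aboveI linear)
    then show ?thesis by simp
  qed
  from lo hi show ?thesis
    by eventually_elim (use J(2) in \<open>auto simp: is_interval_1\<close>)
qed

lemma (in prob_space) AE_real_cond_exp_in_range:
  fixes u :: "real \<Rightarrow> real"
  assumes "is_interval I" and "continuous_on I u" and "subalgebra M G"
    and "Y \<in> space M \<rightarrow> I" and "integrable M (\<lambda>\<omega>. u (Y \<omega>))"
  shows "AE \<omega> in M. real_cond_exp M G (\<lambda>\<omega>. u (Y \<omega>)) \<omega> \<in> u ` I"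
  using assms by (intro AE_real_cond_exp_in_interval is_interval_range) auto

lemma (in prob_space) expectation_in_range:
  fixes u :: "real \<Rightarrow> real"
  assumes "is_interval I" and "continuous_on I u"
    and "Y \<in> space M \<rightarrow> I" and Y: "integrable M (\<lambda>\<omega>. u (Y \<omega>))"
  shows "expectation (\<lambda>\<omega>. u (Y \<omega>)) \<in> u ` I"
proof (rule ccontr)
  let ?e = "expectation (\<lambda>\<omega>. u (Y \<omega>))"
  assume e: "?e \<notin> u ` I"
  have int: "is_interval (u ` I)"
    using assms by (intro is_interval_range)
  have uY: "u (Y \<omega>) \<in> u ` I" if "\<omega> \<in> space M" for \<omega>
    using that assms(3) by auto
  have "(\<forall>z\<in>u ` I. z < ?e) \<or> (\<forall>z\<in>u ` I. ?e < z)"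
    using int e unfolding is_interval_1 by (meson linorder_not_le nle_le)
  then show False
  proof
    assume "\<forall>z\<in>u ` I. z < ?e"
    then have "AE \<omega> in M. u (Y \<omega>) < ?e" using uY by (intro AE_I2) blast
    from expectation_less[OF Y this] show False by simp
  next
    assume "\<forall>z\<in>u ` I. ?e < z"
    then have "AE \<omega> in M. ?e < u (Y \<omega>)" using uY by (intro AE_I2) blast
    from expectation_greater[OF Y this] show False by simp
  qed
qed

end

theory Submission
  imports Defs
begin

text \<open>
  Put \<open>Z k = E[u(X m) | G k]\<close>.  The conditional expectations \<open>Z k\<close> of one fixed integrable variable
  form a martingale by the tower property, and \<open>u\<close> and its inverse carry this martingale to
  \<open>\<pi>\<close> and back.  This is all the theorem says, once the transport is justified: \<open>Z k\<close> stays almost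
  surely in the interval \<open>u ` I\<close> on which the inverse lives (\<open>AE_real_cond_exp_in_range\<close>), so that
  \<open>u (\<pi> k) = Z k\<close> almost surely (\<open>AE_u_of_u_cond_exp\<close>), and the inverse of an increasing function is
  increasing, hence Borel, so that \<open>\<pi> k\<close> is measurable with respect to \<open>G k\<close>
  (\<open>u_cond_exp_measurable\<close>).  The tower property then gives \<open>u_cond_exp_tower\<close>.

  For the value at time zero an almost sure identity is not enough, because the claim is about every
  outcome.  It holds since a function that is measurable with respect to the trivial
  \<open>\<sigma>\<close>-algebra is constant, so the version of the conditional expectation chosen there is the
  expectation itself, without an exceptional set (\<open>real_cond_exp_trivial_subalgebra\<close>).
\<close>

lemma u_cond_exp_in_interval:
  assumes "inj_on u I" and "I \<noteq> {}"
  shows "u_cond_exp M I u G Y \<omega> \<in> I"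
proof -
  have "(SOME c. c \<in> I) \<in> I"
    using assms(2) by (simp add: some_in_eq)
  then show ?thesis
    using assms(1) by (auto simp: u_cond_exp_def Let_def intro: the_inv_into_into)
qed

text \<open>
  The right-hand side no longer mentions the inverse: it is a Borel function of the conditional
  expectation as soon as \<open>u ` I\<close> is a Borel set.  Measurability of \<open>u (u_cond_exp \<dots>)\<close> is read off
  from it, and so is the almost sure identity with the conditional expectation.
\<close>

lemma u_of_u_cond_exp:
  assumes "inj_on u I"
  shows "u (u_cond_exp M I u G Y \<omega>) =
    (if real_cond_exp M G (\<lambda>\<omega>'. u (Y \<omega>')) \<omega> \<in> u ` I
     then real_cond_exp M G (\<lambda>\<omega>'. u (Y \<omega>')) \<omega> else u (SOME c. c \<in> I))"
  using assms by (simp add: u_cond_exp_def Let_def f_the_inv_into_f)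

lemma mono_on_the_inv_into:
  fixes u :: "real \<Rightarrow> real"
  assumes "strict_mono_on I u"
  shows "mono_on (u ` I) (the_inv_into I u)"
proof (rule mono_onI)
  fix r s assume "r \<in> u ` I" "s \<in> u ` I" "r \<le> s"
  then obtain x y where xy: "x \<in> I" "y \<in> I" "r = u x" "s = u y" "u x \<le> u y" by blast
  have "x \<le> y"
    using xy assms by (meson not_le strict_mono_onD)
  then show "the_inv_into I u r \<le> the_inv_into I u s"
    using xy strict_mono_on_imp_inj_on[OF assms] by (simp add: the_inv_into_f_f)
qed

lemma u_cond_exp_measurable:
  fixes u :: "real \<Rightarrow> real"
  assumes "strict_mono_on I u" and "is_interval I" and "continuous_on I u"
  shows "u_cond_exp M I u G Y \<in> borel_measurable G"
proof -
  define h where "h z = (if z \<in> u ` I then the_inv_into I u z else (SOME c. c \<in> I))" for z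
  have J: "u ` I \<in> sets borel"
    using is_interval_range[OF assms(2,3)] by (simp add: real_interval_borel_measurable)
  have "the_inv_into I u \<in> borel_measurable (restrict_space borel (u ` I))"
    by (rule borel_measurable_mono_on_fnc[OF mono_on_the_inv_into[OF assms(1)]])
  then have "h \<in> borel_measurable borel"
    unfolding h_def using J by (subst measurable_If_restrict_space_iff) auto
  then have "(\<lambda>\<omega>. h (real_cond_exp M G (\<lambda>\<omega>'. u (Y \<omega>')) \<omega>)) \<in> borel_measurable G"
    by measurable
  then show ?thesis
    by (simp add: h_def u_cond_exp_def[abs_def] Let_def)
qed

context prob_space
begin

text \<open>
  This is the bridge between \<open>u\<close>-conditional and ordinary conditional expectations.  It rests on
  the convexity of \<open>u ` I\<close>: an average of values in an interval stays in that interval.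
\<close>

lemma AE_u_of_u_cond_exp:
  fixes u :: "real \<Rightarrow> real"
  assumes "is_interval I" and "continuous_on I u" and "inj_on u I" and "subalgebra M G"
    and "Y \<in> space M \<rightarrow> I" and "integrable M (\<lambda>\<omega>. u (Y \<omega>))"
  shows "AE \<omega> in M. u (u_cond_exp M I u G Y \<omega>) = real_cond_exp M G (\<lambda>\<omega>. u (Y \<omega>)) \<omega>"
  using AE_real_cond_exp_in_range[OF assms(1,2,4-6)]
  by eventually_elim (simp add: u_of_u_cond_exp[OF assms(3)])

lemma u_of_u_cond_exp_measurable:
  fixes u :: "real \<Rightarrow> real"
  assumes "is_interval I" and "continuous_on I u" and "inj_on u I"
  shows "(\<lambda>\<omega>. u (u_cond_exp M I u G Y \<omega>)) \<in> borel_measurable M"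
proof -
  have [measurable]: "u ` I \<in> sets borel"
    using is_interval_range[OF assms(1,2)] by (simp add: real_interval_borel_measurable)
  show ?thesis
    unfolding u_of_u_cond_exp[OF assms(3)] by measurable
qed

lemma integrable_u_of_u_cond_exp:
  fixes u :: "real \<Rightarrow> real"
  assumes "is_interval I" and "continuous_on I u" and "inj_on u I" and "subalgebra M G"
    and "Y \<in> space M \<rightarrow> I" and "integrable M (\<lambda>\<omega>. u (Y \<omega>))"
  shows "integrable M (\<lambda>\<omega>. u (u_cond_exp M I u G Y \<omega>))"
proof -
  interpret finite_measure_subalgebra M G
    using assms(4) by unfold_locales
  have "integrable M (real_cond_exp M G (\<lambda>\<omega>. u (Y \<omega>)))"
    using assms(6) by (rule real_cond_exp_int(1))
  then show ?thesis
    by (rule integrable_cong_AE_imp[OF _ u_of_u_cond_exp_measurable[OF assms(1-3)]])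
       (use AE_u_of_u_cond_exp[OF assms] in eventually_elim, simp)
qed

text \<open>
  The tower property passes to \<open>u\<close>-conditional expectations because \<open>u\<close> cancels the inner inverse:
  both sides apply the same inverse to almost surely equal conditional expectations.
\<close>

lemma u_cond_exp_tower:
  fixes u :: "real \<Rightarrow> real"
  assumes "is_interval I" and "continuous_on I u" and "inj_on u I"
    and G: "subalgebra M G" and FG: "subalgebra G F"
    and "Y \<in> space M \<rightarrow> I" and Y: "integrable M (\<lambda>\<omega>. u (Y \<omega>))"
  shows "AE \<omega> in M. u_cond_exp M I u F (u_cond_exp M I u G Y) \<omega> = u_cond_exp M I u F Y \<omega>"
proof -
  have F: "subalgebra M F"
    using G FG by (auto simp: subalgebra_def)
  interpret finite_measure_subalgebra M F
    using F by unfold_locales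
  interpret G: finite_measure_subalgebra M G
    using G by unfold_locales
  have "AE \<omega> in M. real_cond_exp M F (\<lambda>\<omega>. u (u_cond_exp M I u G Y \<omega>)) \<omega>
      = real_cond_exp M F (real_cond_exp M G (\<lambda>\<omega>. u (Y \<omega>))) \<omega>"
    using AE_u_of_u_cond_exp[OF assms(1-3) G assms(6) Y]
      u_of_u_cond_exp_measurable[OF assms(1-3)] borel_measurable_cond_exp2
    by (rule real_cond_exp_cong)
  moreover have "AE \<omega> in M. real_cond_exp M F (real_cond_exp M G (\<lambda>\<omega>. u (Y \<omega>))) \<omega>
      = real_cond_exp M F (\<lambda>\<omega>. u (Y \<omega>)) \<omega>"
    using G FG Y by (rule real_cond_exp_nested_subalg)
  ultimately show ?thesis
    by eventually_elim (simp add: u_cond_exp_def)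
qed

text \<open>
  The identity holds at every outcome: the chosen version is constant, and a constant on a probability
  space equals its own expectation.
\<close>

lemma real_cond_exp_trivial_subalgebra:
  assumes G: "subalgebra M G" and triv: "sets G = {{}, space M}"
    and f: "integrable M f" and \<omega>: "\<omega> \<in> space M"
  shows "real_cond_exp M G f \<omega> = expectation f"
proof -
  interpret finite_measure_subalgebra M G
    using G by unfold_locales
  let ?c = "real_cond_exp M G f \<omega>"
  have "real_cond_exp M G f -` {?c} \<inter> space G \<in> sets G"
    by (rule measurable_sets[OF borel_measurable_cond_exp]) simp
  moreover have "\<omega> \<in> real_cond_exp M G f -` {?c} \<inter> space G"
    using \<omega> G by (simp add: subalgebra_def)
  ultimately have "real_cond_exp M G f -` {?c} \<inter> space G = space M"
    using triv by auto
  then have const: "real_cond_exp M G f x = ?c" if "x \<in> space M" for x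
    using that by blast
  have "expectation f = expectation (real_cond_exp M G f)"
    using real_cond_exp_int(2)[OF f] by simp
  also have "\<dots> = expectation (\<lambda>_. ?c)"
    using const by (intro Bochner_Integration.integral_cong) auto
  finally show ?thesis
    by (simp add: prob_space)
qed

lemma u_cond_exp_trivial_subalgebra:
  fixes u :: "real \<Rightarrow> real"
  assumes "is_interval I" and "continuous_on I u"
    and "subalgebra M G" and "sets G = {{}, space M}"
    and "Y \<in> space M \<rightarrow> I" and "integrable M (\<lambda>\<omega>. u (Y \<omega>))" and "\<omega> \<in> space M"
  shows "u_cond_exp M I u G Y \<omega> = certainty_equiv M I u Y"
  using expectation_in_range[OF assms(1,2,5,6)] real_cond_exp_trivial_subalgebra[OF assms(3,4,6,7)]
  by (simp add: u_cond_exp_def certainty_equiv_def)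

end

theorem theorem5p1:
  fixes M :: "'a measure"
    and I :: "real set"
    and u :: "real \<Rightarrow> real"
    and m :: nat
    and t :: "nat \<Rightarrow> real"
    and T :: real
    and X :: "nat \<Rightarrow> 'a \<Rightarrow> real"
    and G :: "nat \<Rightarrow> 'a measure"
    and \<pi> :: "nat \<Rightarrow> 'a \<Rightarrow> real"
  assumes "prob_space M"
    and "is_interval I"
    and "strict_mono_on I u"
    and "continuous_on I u"
    and "1 \<le> m"
    and "0 < t 1"
    and "strict_mono_on {1..m} t"
    and "t m = T"
    and "\<And>k. k \<le> m \<Longrightarrow> subalgebra M (G k)"
    and "sets (G 0) = {{}, space M}"
    and "\<And>k. k < m \<Longrightarrow> sets (G k) \<subseteq> sets (G (Suc k))"
    and "\<And>k. k \<in> {1..m} \<Longrightarrow> X k \<in> space M \<rightarrow> I"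
    and "\<And>k. k \<in> {1..m} \<Longrightarrow> X k \<in> borel_measurable (G k)"
    and "\<And>k. k \<in> {1..m} \<Longrightarrow> integrable M (\<lambda>\<omega>. u (X k \<omega>))"
    and "\<And>k. k \<le> m \<Longrightarrow> \<pi> k = u_cond_exp M I u (G k) (X m)"
  shows "u_martingale M I u m G \<pi> \<and> (\<forall>\<omega>\<in>space M. \<pi> 0 \<omega> = certainty_equiv M I u (X m))"
proof -
  interpret prob_space M by fact
  have inj: "inj_on u I"
    using \<open>strict_mono_on I u\<close> by (rule strict_mono_on_imp_inj_on)
  have m: "m \<in> {1..m}"
    using \<open>1 \<le> m\<close> by simp
  note X = assms(12)[OF m] and uX = assms(14)[OF m]
  have "I \<noteq> {}"
    using X not_empty by auto
  have mono: "sets (G k) \<subseteq> sets (G l)" if "k \<le> l" "l \<le> m" for k l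
    using that
  proof (induction l rule: dec_induct)
    case (step n)
    then show ?case using assms(11)[of n] by simp
  qed simp
  have nested: "subalgebra (G l) (G k)" if "k \<le> l" "l \<le> m" for k l
    using mono[OF that] assms(9)[of k] assms(9)[of l] that by (simp add: subalgebra_def)
  have "u_martingale M I u m G \<pi>"
    unfolding u_martingale_def
  proof (intro conjI allI impI)
    fix k assume k: "k \<le> m"
    show "\<pi> k \<in> space M \<rightarrow> I"
      using u_cond_exp_in_interval[OF inj \<open>I \<noteq> {}\<close>] assms(15)[OF k] by auto
    show "\<pi> k \<in> borel_measurable (G k)"
      unfolding assms(15)[OF k] by (rule u_cond_exp_measurable[OF assms(3,2,4)])
    show "integrable M (\<lambda>\<omega>. u (\<pi> k \<omega>))"
      unfolding assms(15)[OF k]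
      by (rule integrable_u_of_u_cond_exp[OF assms(2,4) inj assms(9)[OF k] X uX])
  next
    fix k l assume kl: "k \<le> l \<and> l \<le> m"
    then have "k \<le> m" "l \<le> m" by auto
    show "AE \<omega> in M. u_cond_exp M I u (G k) (\<pi> l) \<omega> = \<pi> k \<omega>"
      unfolding assms(15)[OF \<open>k \<le> m\<close>] assms(15)[OF \<open>l \<le> m\<close>]
      using kl by (intro u_cond_exp_tower[OF assms(2,4) inj assms(9)[OF \<open>l \<le> m\<close>] nested X uX]) auto
  qed
  moreover have "\<forall>\<omega>\<in>space M. \<pi> 0 \<omega> = certainty_equiv M I u (X m)"
    using u_cond_exp_trivial_subalgebra[OF assms(2,4) assms(9)[of 0] assms(10) X uX] assms(15)[of 0]
    by simp
  ultimately show ?thesis ..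
qed

end
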